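(* Let $G$ be a finite graph cellularly embedded in a compact, connected, orientable, boundaryless surface $\Sigma$ of genus $g\ge0$, with dual graph $G^*$ and positive coupling constants $(J_{e^*})_{e^*\in E^*}$. XOR loop configurations of the double Ising model on $G^*$ have the same law as $\mathrm{Poly}_1$ configurations of the corresponding dimer model on the bipartite graph $G^Q$: $$\forall P\in\mathcal P^0(G),\qquad \mathbb P_{\mathrm{d\text{-}Ising}}[\mathrm{XOR}=P]=\mathbb P^0_{\mathrm{quadri}}[\mathrm{Poly}_1=P].$$
   Context: $G=(V,E)$, $G^*=(V^*,E^* )$, $e\mapsto e^*$ the bijection between edges and dual edges. A polygon configuration of $G$ is a subset of edges such that every vertex is incident to an even number of them; $\mathcal P^\epsilon(G)$ is the set of those with class $\epsilon\in H_1(\Sigma;\mathbb Z/2\mathbb Z)$. Double Ising model: $\mathbb P_{\mathrm{d\text{-}Ising}}$ is the probability measure on $\bigcup_{\epsilon\in H_1(\Sigma;\mathbb Z/2\mathbb Z)}\mathcal P^\epsilon(G)\times\mathcal P^\epsilon(G)$ for which the probability of $(P_{\mathrm{red}},P_{\mathrm{blue}})$ is proportional to $\prod_{e\in P_{\mathrm{red}}}e^{-2J_{e^*}}\prod_{e\in P_{\mathrm{blue}}}e^{-2J_{e^*}}$. For each $\epsilon$ fix a representative $\underline\epsilon\subset E$, and let $s_\epsilon(e)=-1$ if $e\in\underline\epsilon$, $1$ otherwise. A pair $(P_{\mathrm{red}},P_{\mathrm{blue}})\in\mathcal P^\epsilon(G)^2$ comes from spin configurations $\sigma,\sigma'\in\{-1,1\}^{V^*}$,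 each unique up to global sign, with $P_{\mathrm{red}}=\{e: s_\epsilon(e)\sigma_{u^*}\sigma_{v^*}=-1,\ e^*=u^*v^*\}$ and similarly for $P_{\mathrm{blue}},\sigma'$. $\mathrm{XOR}(P_{\mathrm{red}},P_{\mathrm{blue}})\subset E$ is the set of edges $e$ such that the XOR-spin $\sigma\sigma'$ takes distinct values at the endpoints of $e^*$ (independent of choices). Medial graph $G^M$: it has one (4-valent) vertex $v(e)$ per edge $e$ of $G$, and two medial vertices are joined by an edge through each corner of a face at which the corresponding edges of $G$ are consecutive. The four medial edges at $v(e)$ lie in the four sectors delimited by $e$ and $e^*$. Quadri-tiling graph $G^Q$: it is obtained from $G^M$ by replacing each vertex $v(e)$ by a quadrangle (a 4-cycle) whose four corners are attached, in cyclic order, to the four medial edges at $v(e)$. It is bipartite. Edges coming from $G^M$ are external, the edges of quadrangles are internal. In the quadrangle of $v(e)$, two internal edges are parallel to $e$ (each joins two corners on the same side of $e$) and two are parallel to $e^*$ (each joins two corners on the same side of $e^*$). Dimer configurations (perfect matchings) $M$ of $G^Q$ have weight equal to the product of their edge weights: external edges have weight $1$, internal edges parallel to $e\in E$ have weight $a_e=\frac{2e^{-2J_{e^*}}}{1+e^{-4J_{e^*}}}$, and internal edges parallel to $e^*\in E^*$ have weight $b_{e^*}=\frac{1-e^{-4J_{e^*}}}{1+e^{-4J_{e^*}}}$. Map $\mathrm{Poly}_1$: given $M$, the external edges in $M$ form an edge configuration of $G^M$ such that around each vertex of $G^M$ none, all, or exactly two consecutive edges are present. $\mathrm{Poly}_1(M)\subset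 E$ is the set of $e\in E$ such that exactly two medial edges at $v(e)$ are present and $e$ separates these from the two absent ones. $\mathbb P^0_{\mathrm{quadri}}$ is the probability measure, proportional to the weight, on the set of dimer configurations $M$ such that $\mathrm{Poly}_1(M)$ has zero class in $H_1(\Sigma;\mathbb Z/2\mathbb Z)$. *)

theory Defs
  imports
    "HOL-Probability.Probability_Measure"
    "HOL-Combinatorics.Orbits"
    "Graph_Theory.Bidirected_Digraph"
    "Graph_Theory.Digraph_Component"
begin

section \<open>Graphs cellularly embedded in closed oriented surfaces\<close>

text \<open>
  A finite graph cellularly embedded in a compact connected orientable surface without boundary is
  encoded by its rotation system. Every edge is a pair of opposite arcs, exchanged by \<open>arev\<close>, and
  \<open>rot\<close> maps an arc to the next one counterclockwise around its tail. The surface is recovered by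
  gluing a disc along each orbit of \<open>inv rot \<circ> arev\<close>, so that every genus occurs. Loops and multiple
  edges are allowed.
\<close>

record ('v, 'a) surface_graph =
  skeleton :: "('v, 'a) pre_digraph"
  arev :: "'a \<Rightarrow> 'a"
  rot :: "'a \<Rightarrow> 'a"

definition cellularly_embedded :: "('v, 'a) surface_graph \<Rightarrow> bool" where
  "cellularly_embedded S \<longleftrightarrow>
     fin_digraph (skeleton S) \<and>
     bidirected_digraph (skeleton S) (arev S) \<and>
     Digraph_Component.connected (skeleton S) \<and>
     rot S permutes arcs (skeleton S) \<and>
     (\<forall>v \<in> verts (skeleton S). out_arcs (skeleton S) v \<noteq> {} \<longrightarrow>
        cyclic_on (rot S) (out_arcs (skeleton S) v))"

definition arc_edge :: "('v, 'a) surface_graph \<Rightarrow> 'a \<Rightarrow> 'a set" where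
  "arc_edge S a = {a, arev S a}"

definition edges :: "('v, 'a) surface_graph \<Rightarrow> 'a set set" where
  "edges S = arc_edge S ` arcs (skeleton S)"

text \<open>The face to the left of an arc is given by the set of all arcs having this face on their left.\<close>

definition left_face :: "('v, 'a) surface_graph \<Rightarrow> 'a \<Rightarrow> 'a set" where
  "left_face S a = orbit (inv (rot S) \<circ> arev S) a"

text \<open>The graph with one vertex and no edge has one face (on the sphere), with no arc on its boundary.\<close>

definition faces :: "('v, 'a) surface_graph \<Rightarrow> 'a set set" where
  "faces S = (if arcs (skeleton S) = {} then {{}} else left_face S ` arcs (skeleton S))"

text \<open>
  The dual of the arc \<open>a\<close> crosses \<open>a\<close> from left to right and is again named \<open>a\<close>; reversal of arcs
  is the same in both graphs. The bijection between edges and dual edges is thus the identity on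
  pairs of opposite arcs, and functions of dual edges are functions of such pairs.
\<close>

definition dual_graph :: "('v, 'a) surface_graph \<Rightarrow> ('a set, 'a) pre_digraph" where
  "dual_graph S =
     \<lparr>verts = faces S, arcs = arcs (skeleton S),
      tail = left_face S, head = (\<lambda>a. left_face S (arev S a))\<rparr>"

definition dual_edges :: "('v, 'a) surface_graph \<Rightarrow> 'a set set" where
  "dual_edges S = arc_edge S ` arcs (dual_graph S)"


section \<open>Polygon configurations and first homology modulo 2\<close>

text \<open>A loop leaves its vertex by both of its arcs, hence contributes 2 to the degree.\<close>

definition polygons :: "('v, 'a) surface_graph \<Rightarrow> 'a set set set" where
  "polygons S =
     {P. P \<subseteq> edges S \<and>
         (\<forall>v \<in> verts (skeleton S). even (card {a \<in> out_arcs (skeleton S) v. arc_edge S a \<in> P}))}"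

text \<open>
  Cellular homology: subsets of edges and of faces are the 1-chains and 2-chains with coefficients
  in Z/2Z, addition is symmetric difference, and polygon configurations are the 1-cycles. An edge is
  in the boundary of a set of faces iff exactly one of its two sides is.
\<close>

definition face_boundary :: "('v, 'a) surface_graph \<Rightarrow> 'a set set \<Rightarrow> 'a set set" where
  "face_boundary S F = {e \<in> edges S. odd (card {a \<in> e. left_face S a \<in> F})}"

definition homologous :: "('v, 'a) surface_graph \<Rightarrow> ('a set set \<times> 'a set set) set" where
  "homologous S =
     {(P, Q). P \<in> polygons S \<and> Q \<in> polygons S \<and>
              (\<exists>F \<subseteq> faces S. sym_diff P Q = face_boundary S F)}"

definition H1 :: "('v, 'a) surface_graph \<Rightarrow> 'a set set set set" where
  "H1 S = polygons S // homologous S"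

definition homology_class :: "('v, 'a) surface_graph \<Rightarrow> 'a set set \<Rightarrow> 'a set set set" where
  "homology_class S P = homologous S `` {P}"

definition zero_homology :: "('v, 'a) surface_graph \<Rightarrow> 'a set set set" where
  "zero_homology S = homology_class S {}"

definition polygons_of_class ::
  "('v, 'a) surface_graph \<Rightarrow> 'a set set set \<Rightarrow> 'a set set set" where
  "polygons_of_class S \<epsilon> = {P \<in> polygons S. homology_class S P = \<epsilon>}"


section \<open>The double Ising model\<close>

text \<open>The probability measure on the finite set \<open>\<Omega>\<close> proportional to \<open>w\<close>.\<close>

definition gibbs_measure :: "'c set \<Rightarrow> ('c \<Rightarrow> real) \<Rightarrow> 'c measure" where
  "gibbs_measure \<Omega> w = point_measure \<Omega> (\<lambda>x. ennreal (w x / (\<Sum>y\<in>\<Omega>. w y)))"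

definition dIsing_configs :: "('v, 'a) surface_graph \<Rightarrow> ('a set set \<times> 'a set set) set" where
  "dIsing_configs S = (\<Union>\<epsilon> \<in> H1 S. polygons_of_class S \<epsilon> \<times> polygons_of_class S \<epsilon>)"

definition dIsing_weight :: "('a set \<Rightarrow> real) \<Rightarrow> 'a set set \<times> 'a set set \<Rightarrow> real" where
  "dIsing_weight J =
     (\<lambda>(Pred, Pblue). (\<Prod>e\<in>Pred. exp (- 2 * J e)) * (\<Prod>e\<in>Pblue. exp (- 2 * J e)))"

definition dIsing ::
  "('v, 'a) surface_graph \<Rightarrow> ('a set \<Rightarrow> real) \<Rightarrow> ('a set set \<times> 'a set set) measure" where
  "dIsing S J = gibbs_measure (dIsing_configs S) (dIsing_weight J)"

definition dual_spins :: "('v, 'a) surface_graph \<Rightarrow> ('a set \<Rightarrow> int) set" where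
  "dual_spins S = verts (dual_graph S) \<rightarrow>\<^sub>E {- 1, 1}"

definition rep_sign :: "'a set set \<Rightarrow> 'a set \<Rightarrow> int" where
  "rep_sign R e = (if e \<in> R then - 1 else 1)"

text \<open>The endpoints of the dual of the edge \<open>e\<close> are the dual tails of the two arcs of \<open>e\<close>.\<close>

definition spin_polygon ::
  "('v, 'a) surface_graph \<Rightarrow> 'a set set \<Rightarrow> ('a set \<Rightarrow> int) \<Rightarrow> 'a set set" where
  "spin_polygon S R \<sigma> =
     {e \<in> edges S. rep_sign R e * (\<Prod>a\<in>e. \<sigma> (tail (dual_graph S) a)) = - 1}"

text \<open>
  The spin configuration inducing \<open>P\<close> is only determined up to a global sign; the choice does not
  affect the XOR configuration.
\<close>

definition spins_of ::
  "('v, 'a) surface_graph \<Rightarrow> 'a set set \<Rightarrow> 'a set set \<Rightarrow> 'a set \<Rightarrow> int" where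
  "spins_of S R P = (SOME \<sigma>. \<sigma> \<in> dual_spins S \<and> spin_polygon S R \<sigma> = P)"

text \<open>Here \<open>rep \<epsilon>\<close> is the chosen representative of the homology class \<open>\<epsilon>\<close>.\<close>

definition XOR_config ::
  "('v, 'a) surface_graph \<Rightarrow> ('a set set set \<Rightarrow> 'a set set) \<Rightarrow>
   'a set set \<times> 'a set set \<Rightarrow> 'a set set" where
  "XOR_config S rep =
     (\<lambda>(Pred, Pblue).
        let R = rep (homology_class S Pred);
            \<tau> = (\<lambda>u. spins_of S R Pred u * spins_of S R Pblue u)
        in {e \<in> edges S. \<exists>a\<in>e. \<tau> (tail (dual_graph S) a) \<noteq> \<tau> (head (dual_graph S) a)})"


section \<open>The medial graph and the quadri-tiling graph\<close>

text \<open>The medial edge \<open>a\<close> goes through the corner between the arcs \<open>a\<close> and \<open>rot a\<close>.\<close>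

definition medial_graph :: "('v, 'a) surface_graph \<Rightarrow> ('a set, 'a) pre_digraph" where
  "medial_graph S =
     \<lparr>verts = edges S, arcs = arcs (skeleton S),
      tail = arc_edge S, head = (\<lambda>a. arc_edge S (rot S a))\<rparr>"

datatype side = Lft | Rgt

text \<open>
  The vertices \<open>(a, Lft)\<close> and \<open>(a, Rgt)\<close> are the corners of the quadrangle at \<open>arc_edge S a\<close> in the
  sectors delimited by the dual edge and the half of the edge at the tail of \<open>a\<close>, on the left
  and on the right of \<open>a\<close>. In cyclic order the four corners are \<open>(a, Lft)\<close>, \<open>(a, Rgt)\<close>,
  \<open>(arev a, Lft)\<close>, \<open>(arev a, Rgt)\<close>.
\<close>

definition corners :: "'a set \<Rightarrow> ('a \<times> side) set" where
  "corners e = e \<times> UNIV"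

definition quadri_verts :: "('v, 'a) surface_graph \<Rightarrow> ('a \<times> side) set" where
  "quadri_verts S = (\<Union>e \<in> verts (medial_graph S). corners e)"

definition medial_edge_at :: "('v, 'a) surface_graph \<Rightarrow> 'a \<times> side \<Rightarrow> 'a" where
  "medial_edge_at S x = (case x of (a, Lft) \<Rightarrow> a | (a, Rgt) \<Rightarrow> inv (rot S) a)"

text \<open>
  The graph may have multiple edges, so edges are labelled: \<open>External a\<close> is the medial edge \<open>a\<close>,
  \<open>Parallel a\<close> the internal edge parallel to \<open>arc_edge S a\<close> on the left of \<open>a\<close>, and \<open>Dual_parallel a\<close>
  the internal edge parallel to the dual edge at the tail of \<open>a\<close>.
\<close>

datatype 'a quadri_edge = External 'a | Parallel 'a | Dual_parallel 'a

definition quadri_edges :: "('v, 'a) surface_graph \<Rightarrow> 'a quadri_edge set" where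
  "quadri_edges S =
     External ` arcs (medial_graph S) \<union> Parallel ` arcs (skeleton S)
     \<union> Dual_parallel ` arcs (skeleton S)"

fun quadri_ends :: "('v, 'a) surface_graph \<Rightarrow> 'a quadri_edge \<Rightarrow> ('a \<times> side) set" where
  "quadri_ends S (External a) = {x \<in> quadri_verts S. medial_edge_at S x = a}"
| "quadri_ends S (Parallel a) = {(a, Lft), (arev S a, Rgt)}"
| "quadri_ends S (Dual_parallel a) = {(a, Lft), (a, Rgt)}"

lemma quadri_ends_External:
  assumes "cellularly_embedded S" and "a \<in> arcs (skeleton S)"
  shows "quadri_ends S (External a) = {(a, Lft), (rot S a, Rgt)}"
proof -
  interpret bidirected_digraph "skeleton S" "arev S"
    using assms(1) by (simp add: cellularly_embedded_def)
  have rot: "rot S permutes arcs (skeleton S)"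
    using assms(1) by (simp add: cellularly_embedded_def)
  have verts: "quadri_verts S = arcs (skeleton S) \<times> UNIV"
    by (auto simp: quadri_verts_def medial_graph_def corners_def edges_def arc_edge_def)
  have inv_eq: "inv (rot S) b = a \<longleftrightarrow> b = rot S a" for b
    using rot by (metis permutes_inverses)
  have "rot S a \<in> arcs (skeleton S)"
    using rot assms(2) by (simp add: permutes_in_image)
  then show ?thesis
    using assms(2) permutes_inverses(1)[OF rot]
    by (auto simp: verts medial_edge_at_def inv_eq split: side.splits)
qed


section \<open>The dimer model\<close>

definition dimer_configs :: "('v, 'a) surface_graph \<Rightarrow> 'a quadri_edge set set" where
  "dimer_configs S =
     {M. M \<subseteq> quadri_edges S \<and> (\<forall>x \<in> quadri_verts S. \<exists>!q. q \<in> M \<and> x \<in> quadri_ends S q)}"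

fun edge_weight :: "('v, 'a) surface_graph \<Rightarrow> ('a set \<Rightarrow> real) \<Rightarrow> 'a quadri_edge \<Rightarrow> real" where
  "edge_weight S J (External a) = 1"
| "edge_weight S J (Parallel a) =
     2 * exp (- 2 * J (arc_edge S a)) / (1 + exp (- 4 * J (arc_edge S a)))"
| "edge_weight S J (Dual_parallel a) =
     (1 - exp (- 4 * J (arc_edge S a))) / (1 + exp (- 4 * J (arc_edge S a)))"

definition dimer_weight ::
  "('v, 'a) surface_graph \<Rightarrow> ('a set \<Rightarrow> real) \<Rightarrow> 'a quadri_edge set \<Rightarrow> real" where
  "dimer_weight S J M = (\<Prod>q\<in>M. edge_weight S J q)"

text \<open>
  An edge \<open>e\<close> separates the two present medial edges from the two absent ones iff, for one of the
  two orientations \<open>a\<close> of \<open>e\<close>, the present ones are those in the two sectors on the left of \<open>a\<close>.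
\<close>

definition Poly1 :: "('v, 'a) surface_graph \<Rightarrow> 'a quadri_edge set \<Rightarrow> 'a set set" where
  "Poly1 S M =
     {e \<in> edges S. \<exists>a\<in>e.
        {x \<in> corners e. External (medial_edge_at S x) \<in> M} = {(a, Lft), (arev S a, Rgt)}}"

definition quadri0_configs :: "('v, 'a) surface_graph \<Rightarrow> 'a quadri_edge set set" where
  "quadri0_configs S =
     {M \<in> dimer_configs S. Poly1 S M \<in> polygons_of_class S (zero_homology S)}"

definition quadri0 ::
  "('v, 'a) surface_graph \<Rightarrow> ('a set \<Rightarrow> real) \<Rightarrow> 'a quadri_edge set measure" where
  "quadri0 S J = gibbs_measure (quadri0_configs S) (dimer_weight S J)"

end

theory Submission
  imports Defs
begin

text \<open>
  Both laws are proportional, with the same constant for every \<open>P\<close>, to one contour sum. Write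
  \<open>x\<close>, \<open>a\<close>, \<open>b\<close> for \<open>exp (- 2 J)\<close> and the two internal dimer weights \<open>2 x / (1 + x\<^sup>2)\<close> and
  \<open>(1 - x\<^sup>2) / (1 + x\<^sup>2)\<close>, at each edge. For a polygon configuration \<open>P\<close> of zero homology, the sum runs
  over the sets \<open>A\<close> of non-isolated vertices of \<open>G\<close> whose edge cut avoids \<open>P\<close>; the term of \<open>A\<close> is the product of \<open>a\<close>
  over \<open>P\<close> and of \<open>b\<close> over the cut. The cut of \<open>A\<close>, seen in the dual graph, is a dual polygon
  configuration of zero homology which does not cross \<open>P\<close>.

  On the Ising side the reference representative of the homology class cancels in the product of the
  two spins, so that \<open>XOR\<close> is the symmetric difference of the two polygon configurations
  (\<open>XOR_config_eq_sym_diff\<close>). The weight of \<open>XOR = P\<close> is therefore a sum over all polygon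
  configurations \<open>Q\<close>, of every homology class, of the weight of \<open>(Q, sym_diff Q P)\<close>. The indicator that
  \<open>Q\<close> has even degrees is an average over vertex sets \<open>A\<close> of the sign of the intersection of \<open>Q\<close> with
  the cut of \<open>A\<close> (\<open>polygon_indicator\<close>). Once it is inserted, \<open>Q\<close> is an unconstrained set of edges
  and can be summed edge by edge: an edge of \<open>P\<close> gives \<open>x \<plusminus> x\<close> and any other edge \<open>1 \<plusminus> x\<^sup>2\<close>, with the
  minus sign on the cut. Up to a factor \<open>1 + x\<^sup>2\<close> for each edge, these are \<open>a\<close> or \<open>0\<close>, and \<open>1\<close> or \<open>b\<close>
  (\<open>high_temperature_expansion\<close>).

  On the dimer side, once the external edges are given, the quadrangles are matched independently.
  The local partition function of a quadrangle is that of a free-fermionic vertex model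
  on the medial graph: the weight is \<open>a\<close> or \<open>b\<close> when two consecutive medial edges are present, and
  \<open>1\<close> when all four are, or none; in the last case there are two matchings and
  \<open>a\<^sup>2 + b\<^sup>2 = 1\<close> (\<open>quadrangle_weight_sum\<close>). A medial edge is a corner, that is an incidence of a
  vertex and a face. If \<open>P\<close> is the boundary of a set \<open>F\<close> of faces, a configuration of medial
  edges of nonzero weight has \<open>Poly1 = P\<close> iff its indicator at each corner is the sum modulo 2 of the
  indicators of \<open>F\<close> at the face and of some set \<open>A\<close> at the vertex, where the cut of \<open>A\<close> avoids \<open>P\<close>: turning around a
  vertex, the presence of medial edges and the membership of faces in \<open>F\<close> both change exactly when an edge of \<open>P\<close>
  is crossed (\<open>corner_config_surj\<close>). This again yields the contour sum
  (\<open>dimer_contour_expansion\<close>).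
\<close>

section \<open>Finite Gibbs measures and local sums\<close>

lemma even_card_sym_diff:
  assumes "finite X" "finite Y"
  shows "even (card (sym_diff X Y)) \<longleftrightarrow> even (card X) = even (card Y)"
proof -
  have "card (sym_diff X Y) = card (X - Y) + card (Y - X)"
    using assms by (intro card_Un_disjoint) auto
  moreover have "card X = card (X - Y) + card (X \<inter> Y)" "card Y = card (Y - X) + card (X \<inter> Y)"
    using assms by (simp_all add: card_Diff_subset_Int card_mono Int_commute)
  ultimately show ?thesis by presburger
qed

lemma prob_gibbs_measure:
  assumes "finite \<Omega>" "\<And>x. x \<in> \<Omega> \<Longrightarrow> 0 \<le> w x"
  shows "\<P>(x in gibbs_measure \<Omega> w. X x = k) = (\<Sum>x | x \<in> \<Omega> \<and> X x = k. w x) / sum w \<Omega>"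
proof -
  have "\<P>(x in gibbs_measure \<Omega> w. X x = k) = (\<Sum>x | x \<in> \<Omega> \<and> X x = k. w x / sum w \<Omega>)"
    unfolding gibbs_measure_def using assms
    by (subst measure_point_measure_finite_if) (auto simp: space_point_measure sum_nonneg)
  then show ?thesis by (simp add: sum_divide_distrib)
qed

text \<open>
  It is enough to compare fibre weights up to a common constant: summing over the fibres, the
  partition functions then differ by the same constant, which cancels.
\<close>
lemma gibbs_measures_same_law:
  assumes "finite \<Omega>" "finite \<Omega>'" "finite K"
    and "\<And>x. x \<in> \<Omega> \<Longrightarrow> 0 \<le> w x" "\<And>y. y \<in> \<Omega>' \<Longrightarrow> 0 \<le> w' y"
    and "X ` \<Omega> \<subseteq> K" "Y ` \<Omega>' \<subseteq> K"
    and fibre: "\<And>k. k \<in> K \<Longrightarrow>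
      (\<Sum>x | x \<in> \<Omega> \<and> X x = k. w x) = c * (\<Sum>y | y \<in> \<Omega>' \<and> Y y = k. w' y)"
    and "c \<noteq> 0" "k \<in> K"
  shows "\<P>(x in gibbs_measure \<Omega> w. X x = k) = \<P>(y in gibbs_measure \<Omega>' w'. Y y = k)"
proof -
  have "sum w \<Omega> = (\<Sum>k\<in>K. \<Sum>x | x \<in> \<Omega> \<and> X x = k. w x)"
    using assms by (intro sum.group[symmetric])
  also have "\<dots> = (\<Sum>k\<in>K. c * (\<Sum>y | y \<in> \<Omega>' \<and> Y y = k. w' y))"
    by (intro sum.cong refl fibre)
  also have "\<dots> = c * (\<Sum>k\<in>K. \<Sum>y | y \<in> \<Omega>' \<and> Y y = k. w' y)"
    by (rule sum_distrib_left[symmetric])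
  also have "(\<Sum>k\<in>K. \<Sum>y | y \<in> \<Omega>' \<and> Y y = k. w' y) = sum w' \<Omega>'"
    using assms by (intro sum.group)
  finally have "sum w \<Omega> = c * sum w' \<Omega>'" .
  then show ?thesis
    using assms by (simp add: prob_gibbs_measure)
qed

text \<open>
  When the constraint on a subset of a disjoint union of blocks can be tested block by block, the
  partition function factorizes. The blocks will be the quadrangles.
\<close>
lemma sum_local_choices:
  fixes w :: "'b \<Rightarrow> real"
  assumes "finite E" and "\<And>e. e \<in> E \<Longrightarrow> finite (T e)"
    and "\<And>e e'. e \<in> E \<Longrightarrow> e' \<in> E \<Longrightarrow> e \<noteq> e' \<Longrightarrow> T e \<inter> T e' = {}"
    and "\<And>e. e \<in> E \<Longrightarrow> L e \<subseteq> Pow (T e)"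
  shows "(\<Sum>I | I \<subseteq> (\<Union>e\<in>E. T e) \<and> (\<forall>e\<in>E. I \<inter> T e \<in> L e). \<Prod>q\<in>I. w q) =
         (\<Prod>e\<in>E. \<Sum>K\<in>L e. \<Prod>q\<in>K. w q)"
proof -
  have fin: "finite (L e)" if "e \<in> E" for e
    using that assms by (meson finite_Pow_iff finite_subset)
  have "(\<Prod>e\<in>E. \<Sum>K\<in>L e. \<Prod>q\<in>K. w q) = (\<Sum>g\<in>PiE E L. \<Prod>e\<in>E. \<Prod>q\<in>g e. w q)"
    using assms(1) fin by (simp add: prod_sum_PiE)
  also have "\<dots> = (\<Sum>I | I \<subseteq> (\<Union>e\<in>E. T e) \<and> (\<forall>e\<in>E. I \<inter> T e \<in> L e). \<Prod>q\<in>I. w q)"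
  proof (rule sum.reindex_bij_witness[where i = "\<lambda>I. \<lambda>e\<in>E. I \<inter> T e" and j = "\<lambda>g. \<Union>e\<in>E. g e"])
    fix g assume g: "g \<in> PiE E L"
    then have sub: "g e \<subseteq> T e" if "e \<in> E" for e
      using that assms(4) by (auto simp: PiE_iff)
    have restr: "(\<Union>e\<in>E. g e) \<inter> T e = g e" if "e \<in> E" for e
      using that sub assms(3) by fast
    show "(\<lambda>e\<in>E. (\<Union>e\<in>E. g e) \<inter> T e) = g"
      using g restr by (auto simp: fun_eq_iff PiE_iff extensional_def)
    show "(\<Union>e\<in>E. g e) \<in> {I. I \<subseteq> (\<Union>e\<in>E. T e) \<and> (\<forall>e\<in>E. I \<inter> T e \<in> L e)}"
      using g sub restr by (auto simp: PiE_iff)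
    have "finite (g e)" if "e \<in> E" for e
      using sub[OF that] assms(2)[OF that] by (rule finite_subset)
    moreover have "\<forall>i\<in>E. \<forall>j\<in>E. i \<noteq> j \<longrightarrow> g i \<inter> g j = {}"
      using sub assms(3) by fast
    ultimately show "(\<Prod>q\<in>(\<Union>e\<in>E. g e). w q) = (\<Prod>e\<in>E. \<Prod>q\<in>g e. w q)"
      using assms(1) by (intro prod.UNION_disjoint) auto
  next
    fix I assume "I \<in> {I. I \<subseteq> (\<Union>e\<in>E. T e) \<and> (\<forall>e\<in>E. I \<inter> T e \<in> L e)}"
    then show "(\<lambda>e\<in>E. I \<inter> T e) \<in> PiE E L" "(\<Union>e\<in>E. (\<lambda>e\<in>E. I \<inter> T e) e) = I"
      by auto
  qed
  finally show ?thesis by simp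
qed

lemma sum_Pow_insert:
  fixes f :: "'b set \<Rightarrow> real"
  assumes "finite T" "q \<notin> T"
  shows "(\<Sum>K\<in>Pow (insert q T). f K) = (\<Sum>K\<in>Pow T. f K + f (insert q K))"
proof -
  have "inj_on (insert q) (Pow T)"
    using assms(2) by (auto simp: inj_on_def)
  then show ?thesis
    using assms unfolding Pow_insert
    by (subst sum.union_disjoint) (auto simp: sum.reindex sum.distrib)
qed

section \<open>Corners, faces and edges of an embedded graph\<close>
locale embedded_graph =
  fixes S :: "('v, 'a) surface_graph"
  assumes embedded: "cellularly_embedded S"
begin

sublocale bidirected_digraph "skeleton S" "arev S"
  using embedded by (simp add: cellularly_embedded_def)

abbreviation darts :: "'a set" where "darts \<equiv> arcs (skeleton S)"
abbreviation origin :: "'a \<Rightarrow> 'v" where "origin \<equiv> tail (skeleton S)"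

lemma finite_darts: "finite darts"
  using embedded by (simp add: cellularly_embedded_def fin_digraph.finite_arcs)

lemma rot_permutes: "rot S permutes darts"
  using embedded by (simp add: cellularly_embedded_def)

lemma origin_in_verts: "a \<in> darts \<Longrightarrow> origin a \<in> verts (skeleton S)"
  by simp

lemma cyclic_on_rot: "a \<in> darts \<Longrightarrow> cyclic_on (rot S) (out_arcs (skeleton S) (origin a))"
proof -
  assume "a \<in> darts"
  then have "origin a \<in> verts (skeleton S)" "a \<in> out_arcs (skeleton S) (origin a)" by auto
  then show ?thesis using embedded unfolding cellularly_embedded_def by blast
qed

lemma rot_in_darts [simp]: "rot S a \<in> darts \<longleftrightarrow> a \<in> darts"
  using rot_permutes by (rule permutes_in_image)

lemma inv_rot_in_darts [simp]: "inv (rot S) a \<in> darts \<longleftrightarrow> a \<in> darts"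
  using permutes_inv[OF rot_permutes] by (rule permutes_in_image)

lemma rot_inv [simp]: "rot S (inv (rot S) a) = a" "inv (rot S) (rot S a) = a"
  using rot_permutes by (auto simp: permutes_inverses)

lemma origin_rot: "a \<in> darts \<Longrightarrow> origin (rot S a) = origin a"
proof -
  assume a: "a \<in> darts"
  then have "a \<in> out_arcs (skeleton S) (origin a)" by simp
  with cyclic_on_rot[OF a] have "rot S a \<in> out_arcs (skeleton S) (origin a)"
    by (metis cyclic_on_inI)
  then show ?thesis by simp
qed

lemma origin_inv_rot: "a \<in> darts \<Longrightarrow> origin (inv (rot S) a) = origin a"
  using origin_rot[of "inv (rot S) a"] by simp

text \<open>
  The corner that precedes \<open>a\<close> around its tail lies on the right of \<open>a\<close>, hence in the face on
  the left of the reversed arc.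
\<close>
lemma left_face_inv_rot: "left_face S (inv (rot S) a) = left_face S (arev S a)"
proof -
  have "(inv (rot S) \<circ> arev S) permutes darts"
    using arev_permutes_arcs permutes_inv[OF rot_permutes] by (rule permutes_compose)
  then have "permutation (inv (rot S) \<circ> arev S)"
    using finite_darts by (auto simp: permutation_permutes)
  from permutation_orbit_step[OF this, of "arev S a"] show ?thesis
    by (simp add: left_face_def)
qed

text \<open>This is how a function of corners descends to a function of vertices.\<close>
lemma rot_invariant_imp_origin_invariant:
  assumes inv: "\<And>a. a \<in> darts \<Longrightarrow> f (rot S a) = f a"
    and "a \<in> darts" "b \<in> darts" "origin a = origin b"
  shows "f a = f b"
proof -
  have "cyclic_on (rot S) (out_arcs (skeleton S) (origin a))"
    using assms by (simp add: cyclic_on_rot)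
  then have "b \<in> orbit (rot S) a"
    using assms by (subst (asm) cyclic_on_alldef) auto
  then show ?thesis
  proof (induction rule: orbit.induct)
    case base then show ?case using inv assms(2) by simp
  next
    case (step y)
    have "y \<in> darts" using step(1) permutes_orbit_subset[OF rot_permutes assms(2)] by blast
    then show ?case using step inv by simp
  qed
qed

lemma left_face_in_faces: "a \<in> darts \<Longrightarrow> left_face S a \<in> faces S"
  by (auto simp: faces_def)

lemma finite_edges: "finite (edges S)"
  by (simp add: edges_def finite_darts)

lemma arc_edge_in_edges: "a \<in> darts \<Longrightarrow> arc_edge S a \<in> edges S"
  by (simp add: edges_def)

lemma edgeE:
  assumes "e \<in> edges S"
  obtains a where "a \<in> darts" "arev S a \<in> darts" "arev S a \<noteq> a" "e = {a, arev S a}" "arc_edge S a = e"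
proof -
  obtain a where a: "a \<in> darts" "e = arc_edge S a"
    using assms unfolding edges_def by blast
  from that[OF a(1) arev_in_arcs[OF a(1)] arev_neq[OF a(1)]] a(2) show thesis
    unfolding arc_edge_def by blast
qed

lemma edge_eqI:
  assumes "e \<in> edges S" "a \<in> e"
  shows "arc_edge S a = e"
proof -
  obtain b where "e = {b, arev S b}" using assms(1) by (rule edgeE)
  then show ?thesis using assms(2) by (auto simp: arc_edge_def)
qed

lemma edges_disjoint: "e \<in> edges S \<Longrightarrow> e' \<in> edges S \<Longrightarrow> e \<noteq> e' \<Longrightarrow> e \<inter> e' = {}"
  using edge_eqI by blast

lemma finite_edge:
  assumes "e \<in> edges S" shows "finite e"
proof -
  obtain b where "e = {b, arev S b}" using assms by (rule edgeE)
  then show ?thesis by simp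
qed

lemma Union_edges: "\<Union>(edges S) = darts"
  by (auto simp: edges_def arc_edge_def)

section \<open>Homology classes of polygon configurations\<close>

lemma odd_card_edge:
  assumes "a \<in> darts"
  shows "odd (card {b \<in> arc_edge S a. Q b}) \<longleftrightarrow> Q a \<noteq> Q (arev S a)"
proof -
  have "{b \<in> arc_edge S a. Q b} = (if Q a then {a} else {}) \<union> (if Q (arev S a) then {arev S a} else {})"
    by (auto simp: arc_edge_def)
  then show ?thesis using arev_neq[OF assms] by auto
qed

lemma face_boundary_iff:
  "a \<in> darts \<Longrightarrow>
    arc_edge S a \<in> face_boundary S F \<longleftrightarrow> (left_face S a \<in> F) \<noteq> (left_face S (arev S a) \<in> F)"
  unfolding face_boundary_def by (simp add: arc_edge_in_edges odd_card_edge)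

lemma edges_eqI:
  assumes "X \<subseteq> edges S" "Y \<subseteq> edges S" "\<And>a. a \<in> darts \<Longrightarrow> arc_edge S a \<in> X \<longleftrightarrow> arc_edge S a \<in> Y"
  shows "X = Y"
  using assms unfolding edges_def by blast

lemma face_boundary_subset: "face_boundary S F \<subseteq> edges S"
  by (auto simp: face_boundary_def)

lemma face_boundary_sym_diff:
  "face_boundary S (sym_diff F F') = sym_diff (face_boundary S F) (face_boundary S F')"
  using face_boundary_subset by (intro edges_eqI) (auto simp: face_boundary_iff)

lemma face_boundary_empty: "face_boundary S {} = {}"
  by (auto simp: face_boundary_def)

lemma polygons_sym_diff:
  assumes "P \<in> polygons S" "Q \<in> polygons S"
  shows "sym_diff P Q \<in> polygons S"
proof -
  have "even (card {a \<in> out_arcs (skeleton S) v. arc_edge S a \<in> sym_diff P Q})"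
    if "v \<in> verts (skeleton S)" for v
  proof -
    have "{a \<in> out_arcs (skeleton S) v. arc_edge S a \<in> sym_diff P Q} =
        sym_diff {a \<in> out_arcs (skeleton S) v. arc_edge S a \<in> P}
                 {a \<in> out_arcs (skeleton S) v. arc_edge S a \<in> Q}" by blast
    moreover have "finite {a \<in> out_arcs (skeleton S) v. arc_edge S a \<in> R}" for R
      by (rule finite_subset[OF _ finite_darts]) auto
    ultimately show ?thesis
      using assms that by (simp only: even_card_sym_diff) (simp add: polygons_def)
  qed
  then show ?thesis using assms by (auto simp: polygons_def)
qed

lemma finite_polygons: "finite (polygons S)"
  by (rule finite_subset[of _ "Pow (edges S)"]) (auto simp: polygons_def finite_edges)

lemma equiv_homologous: "equiv (polygons S) (homologous S)"
proof (rule equivI)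
  show "homologous S \<subseteq> polygons S \<times> polygons S" by (auto simp: homologous_def)
  show "refl_on (polygons S) (homologous S)"
    by (auto simp: refl_on_def homologous_def face_boundary_empty intro!: exI[of _ "{}"])
  show "sym (homologous S)"
    by (auto simp: sym_def homologous_def Un_commute)
  show "trans (homologous S)"
  proof (rule transI)
    fix P Q R assume "(P, Q) \<in> homologous S" "(Q, R) \<in> homologous S"
    then obtain F F' where "P \<in> polygons S" "R \<in> polygons S" "F \<subseteq> faces S" "F' \<subseteq> faces S"
      and F: "sym_diff P Q = face_boundary S F" "sym_diff Q R = face_boundary S F'"
      by (auto simp: homologous_def)
    have "sym_diff P R = sym_diff (sym_diff P Q) (sym_diff Q R)" by blast
    also have "\<dots> = face_boundary S (sym_diff F F')"
      by (simp only: F face_boundary_sym_diff)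
    finally show "(P, R) \<in> homologous S"
      using \<open>P \<in> _\<close> \<open>R \<in> _\<close> \<open>F \<subseteq> _\<close> \<open>F' \<subseteq> _\<close> unfolding homologous_def
      by (auto intro!: exI[of _ "sym_diff F F'"])
  qed
qed

lemma homology_class_eq_iff:
  "P \<in> polygons S \<Longrightarrow> Q \<in> polygons S \<Longrightarrow>
    homology_class S P = homology_class S Q \<longleftrightarrow> (P, Q) \<in> homologous S"
  unfolding homology_class_def by (rule eq_equiv_class_iff[OF equiv_homologous])

lemma homology_class_in_H1: "P \<in> polygons S \<Longrightarrow> homology_class S P \<in> H1 S"
  unfolding homology_class_def H1_def by (rule quotientI)

lemma homologous_imp_polygons: "(P, Q) \<in> homologous S \<Longrightarrow> P \<in> polygons S \<and> Q \<in> polygons S"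
  by (simp add: homologous_def)

lemma polygons_of_zero_class_iff:
  "P \<in> polygons_of_class S (zero_homology S) \<longleftrightarrow>
     P \<in> polygons S \<and> (\<exists>F \<subseteq> faces S. P = face_boundary S F)"
proof -
  have "{} \<in> polygons S" by (simp add: polygons_def)
  then have "P \<in> polygons_of_class S (zero_homology S) \<longleftrightarrow> P \<in> polygons S \<and> (P, {}) \<in> homologous S"
    unfolding polygons_of_class_def zero_homology_def using homology_class_eq_iff by auto
  then show ?thesis using \<open>{} \<in> polygons S\<close> by (auto simp: homologous_def)
qed

lemma dIsing_configs_eq: "dIsing_configs S = homologous S"
proof -
  have "(P, Q) \<in> dIsing_configs S \<longleftrightarrow> (P, Q) \<in> homologous S" for P Q
    unfolding dIsing_configs_def polygons_of_class_def
    using homology_class_eq_iff[of P Q] homology_class_in_H1[of P] homologous_imp_polygons[of P Q]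
    by auto
  then show ?thesis by auto
qed

text \<open>
  With \<open>dIsing_configs_eq\<close>, the double Ising model lives on all pairs of polygon configurations whose symmetric
  difference has zero homology. Given such a difference \<open>P\<close>, the first member \<open>Q\<close> of the
  pair is thus an arbitrary polygon configuration.
\<close>
lemma homologous_iff_sym_diff:
  "(Q, Q') \<in> homologous S \<longleftrightarrow>
     Q \<in> polygons S \<and> Q' \<in> polygons S \<and> sym_diff Q Q' \<in> polygons_of_class S (zero_homology S)"
  unfolding polygons_of_zero_class_iff using polygons_sym_diff by (auto simp: homologous_def)

section \<open>The XOR configuration is a symmetric difference\<close>

text \<open>
  If \<open>Q\<close> and \<open>R\<close> differ by the boundary of \<open>F\<close>, the spin that is \<open>- 1\<close> exactly on \<open>F\<close> induces \<open>Q\<close>, so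
  that the choice in \<open>spins_of\<close> is made in a nonempty set.
\<close>

lemma spins_of_correct:
  assumes "(Q, R) \<in> homologous S"
  shows "spins_of S R Q \<in> dual_spins S" "spin_polygon S R (spins_of S R Q) = Q"
proof -
  obtain F where F: "F \<subseteq> faces S" "sym_diff Q R = face_boundary S F" and "Q \<subseteq> edges S"
    using assms by (auto simp: homologous_def polygons_def)
  let ?\<sigma> = "\<lambda>f\<in>faces S. if f \<in> F then - 1 else (1 :: int)"
  have "?\<sigma> \<in> dual_spins S" by (auto simp: dual_spins_def dual_graph_def)
  moreover have "spin_polygon S R ?\<sigma> = Q"
  proof (rule edges_eqI)
    fix a assume a: "a \<in> darts"
    have "arc_edge S a \<in> Q \<longleftrightarrow> (arc_edge S a \<in> R) \<noteq> (arc_edge S a \<in> face_boundary S F)"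
      unfolding F(2)[symmetric] by blast
    then show "arc_edge S a \<in> spin_polygon S R ?\<sigma> \<longleftrightarrow> arc_edge S a \<in> Q"
      unfolding spin_polygon_def face_boundary_iff[OF a]
      using a arev_neq[OF a] arc_edge_in_edges[OF a]
      by (auto simp: rep_sign_def dual_graph_def arc_edge_def left_face_in_faces)
  qed (use \<open>Q \<subseteq> edges S\<close> in \<open>auto simp: spin_polygon_def\<close>)
  ultimately have "?\<sigma> \<in> dual_spins S \<and> spin_polygon S R ?\<sigma> = Q" by blast
  then have "spins_of S R Q \<in> dual_spins S \<and> spin_polygon S R (spins_of S R Q) = Q"
    unfolding spins_of_def by (rule someI[of "\<lambda>\<sigma>. \<sigma> \<in> dual_spins S \<and> spin_polygon S R \<sigma> = Q"])
  then show "spins_of S R Q \<in> dual_spins S" "spin_polygon S R (spins_of S R Q) = Q" by auto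
qed

lemma spin_polygon_iff:
  assumes "\<sigma> \<in> dual_spins S" "a \<in> darts"
  shows "arc_edge S a \<in> spin_polygon S R \<sigma> \<longleftrightarrow>
    (arc_edge S a \<in> R) \<noteq> (\<sigma> (left_face S a) \<noteq> \<sigma> (left_face S (arev S a)))"
proof -
  have "\<sigma> (left_face S a) \<in> {-1, 1}" "\<sigma> (left_face S (arev S a)) \<in> {-1, 1}"
    using assms left_face_in_faces by (auto simp: dual_spins_def dual_graph_def PiE_iff)
  then show ?thesis
    using assms(2) arev_neq[OF assms(2)] arc_edge_in_edges
    by (auto simp: spin_polygon_def dual_graph_def arc_edge_def rep_sign_def)
qed

text \<open>
  Both spins are computed with the same representative \<open>R\<close>. Along a dual edge each of them changes iff
  \<open>R\<close> and its own polygon configuration disagree there, so \<open>R\<close> drops out of the product.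
\<close>
lemma XOR_config_eq_sym_diff:
  assumes rep: "\<forall>\<epsilon> \<in> H1 S. rep \<epsilon> \<in> polygons_of_class S \<epsilon>"
    and hom: "(Q, Q') \<in> homologous S"
  shows "XOR_config S rep (Q, Q') = sym_diff Q Q'"
proof -
  define R where "R = rep (homology_class S Q)"
  define \<sigma> where "\<sigma> = spins_of S R Q"
  define \<sigma>' where "\<sigma>' = spins_of S R Q'"
  have "Q \<in> polygons S" "Q' \<in> polygons S" using hom by (auto simp: homologous_def)
  then have "R \<in> polygons S" "homology_class S R = homology_class S Q"
    using rep homology_class_in_H1 by (auto simp: R_def polygons_of_class_def)
  then have "(Q, R) \<in> homologous S"
    using homology_class_eq_iff[OF \<open>Q \<in> _\<close> \<open>R \<in> _\<close>] by simp
  moreover from this have "(Q', R) \<in> homologous S"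
    using hom equiv_homologous by (meson equivE symE transE)
  ultimately have \<sigma>: "\<sigma> \<in> dual_spins S" "spin_polygon S R \<sigma> = Q"
    and \<sigma>': "\<sigma>' \<in> dual_spins S" "spin_polygon S R \<sigma>' = Q'"
    using spins_of_correct unfolding \<sigma>_def \<sigma>'_def by auto
  have X: "XOR_config S rep (Q, Q') =
    {e \<in> edges S. \<exists>a\<in>e. \<sigma> (left_face S a) * \<sigma>' (left_face S a)
       \<noteq> \<sigma> (left_face S (arev S a)) * \<sigma>' (left_face S (arev S a))}"
    by (simp add: XOR_config_def Let_def R_def \<sigma>_def \<sigma>'_def dual_graph_def)
  show ?thesis
  proof (rule edges_eqI)
    fix a assume a: "a \<in> darts"
    have "\<sigma> (left_face S b) \<in> {-1, 1} \<and> \<sigma>' (left_face S b) \<in> {-1, 1}" if "b \<in> darts" for b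
      using that left_face_in_faces \<sigma>(1) \<sigma>'(1) by (auto simp: dual_spins_def dual_graph_def PiE_iff)
    from this[of a] this[of "arev S a"] a
    have "arc_edge S a \<in> XOR_config S rep (Q, Q') \<longleftrightarrow>
      (\<sigma> (left_face S a) \<noteq> \<sigma> (left_face S (arev S a))) \<noteq>
      (\<sigma>' (left_face S a) \<noteq> \<sigma>' (left_face S (arev S a)))"
      unfolding X by (auto simp: arc_edge_in_edges) (auto simp: arc_edge_def)
    then show "arc_edge S a \<in> XOR_config S rep (Q, Q') \<longleftrightarrow> arc_edge S a \<in> sym_diff Q Q'"
      using spin_polygon_iff[OF \<sigma>(1) a, of R] spin_polygon_iff[OF \<sigma>'(1) a, of R] \<sigma>(2) \<sigma>'(2)
      by auto
  qed (use \<open>Q \<in> _\<close> \<open>Q' \<in> _\<close> in \<open>auto simp: X polygons_def\<close>)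
qed

section \<open>High temperature expansion of the double Ising model\<close>

text \<open>
  Isolated vertices are left out: no corner sees them, so that a set of vertices could
  not be recovered from the dimer configuration below. They do not constrain polygon configurations.
\<close>

abbreviation origins :: "'v set" where "origins \<equiv> origin ` darts"

definition vertex_cut :: "'v set \<Rightarrow> 'a set set" where
  "vertex_cut A = {e \<in> edges S. odd (card {a \<in> e. origin a \<in> A})}"

lemma vertex_cut_iff:
  "a \<in> darts \<Longrightarrow> arc_edge S a \<in> vertex_cut A \<longleftrightarrow> (origin a \<in> A) \<noteq> (origin (arev S a) \<in> A)"
  unfolding vertex_cut_def
  by (simp only: mem_Collect_eq arc_edge_in_edges odd_card_edge simp_thms)

text \<open>
  The intersection of \<open>Q\<close> with the cut of \<open>A\<close> has the parity of the sum over \<open>A\<close> of the degrees in \<open>Q\<close>: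
  an edge with both ends in \<open>A\<close>, in particular a loop, is counted twice.
\<close>
lemma prod_vertex_signs:
  fixes A :: "'v set"
  assumes "Q \<subseteq> edges S" "A \<subseteq> origins"
  shows "(\<Prod>e\<in>Q. if e \<in> vertex_cut A then - 1 else 1 :: real) =
    (\<Prod>v\<in>A. (- 1) ^ card {a \<in> out_arcs (skeleton S) v. arc_edge S a \<in> Q})"
proof -
  define s where "s = (\<lambda>v. if v \<in> A then - 1 else 1 :: real)"
  have sub: "\<Union>Q \<subseteq> darts"
    using assms(1) Union_edges by blast
  then have "finite (\<Union>Q)"
    using finite_darts by (rule finite_subset)
  have out: "{a \<in> \<Union>Q. origin a = v} = {a \<in> out_arcs (skeleton S) v. arc_edge S a \<in> Q}" for v
  proof -
    have "a \<in> \<Union>Q \<longleftrightarrow> arc_edge S a \<in> Q" for a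
      using assms(1) edge_eqI by (auto simp: arc_edge_def)
    then show ?thesis using sub by (auto simp: out_arcs_def)
  qed
  have "(\<Prod>e\<in>Q. if e \<in> vertex_cut A then - 1 else 1) = (\<Prod>e\<in>Q. \<Prod>a\<in>e. s (origin a))"
  proof (rule prod.cong)
    fix e assume "e \<in> Q"
    then have "e \<in> edges S" using assms(1) by blast
    then obtain a where a: "a \<in> darts" "arev S a \<in> darts" "arev S a \<noteq> a" "e = {a, arev S a}"
      "arc_edge S a = e" by (rule edgeE)
    have "e \<in> vertex_cut A \<longleftrightarrow> (origin a \<in> A) \<noteq> (origin (arev S a) \<in> A)"
      using vertex_cut_iff[OF a(1), of A] unfolding a(5) .
    moreover have "(\<Prod>b\<in>e. s (origin b)) = s (origin a) * s (origin (arev S a))"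
      unfolding a(4) using a(3) by (subst prod.insert) auto
    ultimately show "(if e \<in> vertex_cut A then - 1 else 1) = (\<Prod>b\<in>e. s (origin b))"
      by (simp only: s_def split: if_split) simp
  qed simp
  also have "\<dots> = (\<Prod>a\<in>\<Union>Q. s (origin a))"
  proof -
    have "\<forall>e\<in>Q. finite e" "\<forall>e\<in>Q. \<forall>e'\<in>Q. e \<noteq> e' \<longrightarrow> e \<inter> e' = {}"
      using assms(1) finite_edge edges_disjoint by (meson subsetD)+
    then show ?thesis by (simp add: prod.Union_disjoint)
  qed
  also have "\<dots> = (\<Prod>v\<in>origins. \<Prod>a | a \<in> \<Union>Q \<and> origin a = v. s (origin a))"
    using sub finite_darts \<open>finite (\<Union>Q)\<close> by (intro prod.group[symmetric]) auto
  also have "\<dots> = (\<Prod>v\<in>origins. s v ^ card {a \<in> out_arcs (skeleton S) v. arc_edge S a \<in> Q})"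
    unfolding out[symmetric] by (intro prod.cong) auto
  also have "\<dots> = (\<Prod>v\<in>A. s v ^ card {a \<in> out_arcs (skeleton S) v. arc_edge S a \<in> Q})"
    using assms(2) finite_darts by (intro prod.mono_neutral_right) (auto simp: s_def)
  also have "\<dots> = (\<Prod>v\<in>A. (- 1) ^ card {a \<in> out_arcs (skeleton S) v. arc_edge S a \<in> Q})"
    by (intro prod.cong) (auto simp: s_def)
  finally show ?thesis .
qed

lemma polygons_iff_origins:
  "Q \<in> polygons S \<longleftrightarrow> Q \<subseteq> edges S \<and>
     (\<forall>v \<in> origins. even (card {a \<in> out_arcs (skeleton S) v. arc_edge S a \<in> Q}))"
proof -
  have "even (card {a \<in> out_arcs (skeleton S) v. arc_edge S a \<in> Q})" if "v \<notin> origins" for v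
  proof -
    have "out_arcs (skeleton S) v = {}" using that by (auto simp: out_arcs_def)
    then show ?thesis by simp
  qed
  then show ?thesis using origin_in_verts unfolding polygons_def by blast
qed

text \<open>
  Orthogonality of characters modulo 2: cycles are the orthogonal complement of cuts. By
  \<open>prod_vertex_signs\<close> the sum over \<open>A\<close> splits into a product over vertices of \<open>1 \<plusminus> 1\<close>, with sign given by
  the parity of the degree.
\<close>
lemma polygon_indicator:
  assumes "Q \<subseteq> edges S"
  shows "(\<Sum>A\<in>Pow origins. \<Prod>e\<in>Q. if e \<in> vertex_cut A then - 1 else 1 :: real) =
    (if Q \<in> polygons S then 2 ^ card origins else 0)"
proof -
  let ?d = "\<lambda>v. card {a \<in> out_arcs (skeleton S) v. arc_edge S a \<in> Q}"
  have "(\<Sum>A\<in>Pow origins. \<Prod>e\<in>Q. if e \<in> vertex_cut A then - 1 else 1 :: real) =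
    (\<Sum>A\<in>Pow origins. (\<Prod>v\<in>A. (- 1) ^ ?d v) * (\<Prod>v\<in>origins - A. 1))"
    using assms by (intro sum.cong) (auto simp: prod_vertex_signs)
  also have "\<dots> = (\<Prod>v\<in>origins. (- 1) ^ ?d v + 1)"
    using finite_darts by (intro prod_add[symmetric]) auto
  also have "\<dots> = (if Q \<in> polygons S then 2 ^ card origins else 0)"
  proof (cases "Q \<in> polygons S")
    case True
    then have "(\<Prod>v\<in>origins. (- 1) ^ ?d v + 1) = (\<Prod>v\<in>origins. 2 :: real)"
      unfolding polygons_iff_origins by (intro prod.cong) auto
    then show ?thesis using True by simp
  next
    case False
    then obtain v where "v \<in> origins" "odd (?d v)"
      using assms unfolding polygons_iff_origins by blast
    then have "\<exists>v\<in>origins. (- 1) ^ ?d v + 1 = (0 :: real)" by (intro bexI[of _ v]) auto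
    then have "(\<Prod>v\<in>origins. (- 1) ^ ?d v + 1) = (0 :: real)"
      using finite_darts by (intro prod_zero) auto
    then show ?thesis using False by simp
  qed
  finally show ?thesis .
qed

text \<open>
  The weight of the edge \<open>e\<close> in the pair formed by the primal contours \<open>P\<close> and the dual contours that
  surround \<open>A\<close>. The value 0 forbids crossings.
\<close>
definition contour_factor :: "('a set \<Rightarrow> real) \<Rightarrow> 'a set set \<Rightarrow> 'v set \<Rightarrow> 'a set \<Rightarrow> real" where
  "contour_factor J P A e =
    (if e \<in> P then if e \<in> vertex_cut A then 0 else 2 * exp (- 2 * J e) / (1 + exp (- 4 * J e))
     else if e \<in> vertex_cut A then (1 - exp (- 4 * J e)) / (1 + exp (- 4 * J e)) else 1)"

lemma high_temperature_expansion:
  assumes "P \<subseteq> edges S"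
  shows "2 ^ card origins * (\<Sum>Q\<in>polygons S. dIsing_weight J (Q, sym_diff Q P)) =
    (\<Prod>e\<in>edges S. 1 + exp (- 4 * J e)) * (\<Sum>A\<in>Pow origins. \<Prod>e\<in>edges S. contour_factor J P A e)"
proof -
  define x where "x e = exp (- 2 * J e)" for e
  (* f and g are the weights of an edge according to whether it belongs to Q or not; outside P the
     edge belongs to both or to none of Q and its symmetric difference with P *)
  define f where "f e = (if e \<in> P then x e else x e * x e)" for e
  define g where "g e = (if e \<in> P then x e else 1)" for e
  have x4: "exp (- 4 * J e) = x e * x e" for e
    by (simp add: x_def mult_exp_exp)
  have w: "dIsing_weight J (Q, sym_diff Q P) = (\<Prod>e\<in>Q. f e) * (\<Prod>e\<in>edges S - Q. g e)"
    if "Q \<subseteq> edges S" for Q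
  proof -
    have restrict: "(\<Prod>e\<in>R. h e) = (\<Prod>e\<in>edges S. if e \<in> R then h e else 1)"
      if "R \<subseteq> edges S" for R and h :: "'a set \<Rightarrow> real"
      using that finite_edges by (subst prod.inter_restrict[symmetric]) (auto simp: Int_absorb1)
    have "sym_diff Q P \<subseteq> edges S" "edges S - Q \<subseteq> edges S" using that assms by auto
    then show ?thesis
      unfolding dIsing_weight_def case_prod_conv x_def[symmetric]
      by (simp only: restrict[of Q, OF that] restrict[of "sym_diff Q P"]
           restrict[of "edges S - Q"] prod.distrib[symmetric])
         (rule prod.cong, auto simp: f_def g_def)
  qed
  have "2 ^ card origins * (\<Sum>Q\<in>polygons S. dIsing_weight J (Q, sym_diff Q P)) =
    (\<Sum>Q\<in>polygons S. dIsing_weight J (Q, sym_diff Q P) * 2 ^ card origins)"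
    by (simp add: sum_distrib_left mult.commute)
  also have "\<dots> = (\<Sum>Q\<in>Pow (edges S). dIsing_weight J (Q, sym_diff Q P) *
      (if Q \<in> polygons S then 2 ^ card origins else 0))"
    using finite_edges by (intro sum.mono_neutral_cong_left) (auto simp: polygons_def)
  also have "\<dots> = (\<Sum>Q\<in>Pow (edges S). \<Sum>A\<in>Pow origins.
      (\<Prod>e\<in>Q. f e * (if e \<in> vertex_cut A then - 1 else 1)) * (\<Prod>e\<in>edges S - Q. g e))"
    by (intro sum.cong refl)
       (simp add: polygon_indicator[symmetric] w sum_distrib_left prod.distrib mult_ac)
  also have "\<dots> = (\<Sum>A\<in>Pow origins. \<Sum>Q\<in>Pow (edges S).
      (\<Prod>e\<in>Q. f e * (if e \<in> vertex_cut A then - 1 else 1)) * (\<Prod>e\<in>edges S - Q. g e))"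
    by (rule sum.swap)
  also have "\<dots> = (\<Sum>A\<in>Pow origins. \<Prod>e\<in>edges S. f e * (if e \<in> vertex_cut A then - 1 else 1) + g e)"
    by (simp only: prod_add[OF finite_edges])
  also have "\<dots> = (\<Sum>A\<in>Pow origins. \<Prod>e\<in>edges S. (1 + exp (- 4 * J e)) * contour_factor J P A e)"
  proof (intro sum.cong prod.cong refl)
    fix A e
    have "1 + x e * x e > 0" by (simp add: x_def add_pos_pos)
    then show "f e * (if e \<in> vertex_cut A then - 1 else 1) + g e =
        (1 + exp (- 4 * J e)) * contour_factor J P A e"
      unfolding f_def g_def contour_factor_def x4 x_def[symmetric] by simp
  qed
  also have "\<dots> = (\<Prod>e\<in>edges S. 1 + exp (- 4 * J e)) *
      (\<Sum>A\<in>Pow origins. \<Prod>e\<in>edges S. contour_factor J P A e)"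
    by (simp add: prod.distrib sum_distrib_left)
  finally show ?thesis .
qed

section \<open>Dimer configurations with given external edges\<close>

lemma quadri_verts_eq: "quadri_verts S = darts \<times> UNIV"
  unfolding quadri_verts_def medial_graph_def corners_def using Union_edges by auto

lemma covers_Lft_iff:
  "b \<in> darts \<Longrightarrow> (b, Lft) \<in> quadri_ends S q \<longleftrightarrow> q = External b \<or> q = Parallel b \<or> q = Dual_parallel b"
  by (cases q) (auto simp: quadri_verts_eq medial_edge_at_def)

lemma covers_Rgt_iff:
  "b \<in> darts \<Longrightarrow> (b, Rgt) \<in> quadri_ends S q \<longleftrightarrow>
    q = External (inv (rot S) b) \<or> q = Parallel (arev S b) \<or> q = Dual_parallel b"
  by (cases q) (auto simp: quadri_verts_eq medial_edge_at_def)

definition quadrangle :: "'a set \<Rightarrow> 'a quadri_edge set" where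
  "quadrangle e = Parallel ` e \<union> Dual_parallel ` e"

text \<open>
  The ways to complete the external edges \<open>N\<close> inside the quadrangle of \<open>e\<close>. The edges \<open>N\<close> at other
  quadrangles can be kept in the condition, because they do not meet the corners of \<open>e\<close>.
\<close>
definition quadrangle_matchings :: "'a set \<Rightarrow> 'a set \<Rightarrow> 'a quadri_edge set set" where
  "quadrangle_matchings N e =
     {K. K \<subseteq> quadrangle e \<and> (\<forall>x\<in>corners e. \<exists>!q. q \<in> External ` N \<union> K \<and> x \<in> quadri_ends S q)}"

lemma ex1_three_iff:
  assumes "distinct [p, q, r]"
  shows "(\<exists>!x. x \<in> M \<and> (x = p \<or> x = q \<or> x = r)) \<longleftrightarrow>
    (p \<in> M \<and> q \<notin> M \<and> r \<notin> M) \<or> (p \<notin> M \<and> q \<in> M \<and> r \<notin> M) \<or> (p \<notin> M \<and> q \<notin> M \<and> r \<in> M)"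
  using assms by auto

text \<open>
  \<open>L b\<close> and \<open>R b\<close> tell whether the medial edges on the left and on the right of \<open>b\<close>, at its tail, are
  present. In cyclic order around the quadrangle the four values are \<open>L a\<close>, \<open>R a\<close>,
  \<open>L (arev S a)\<close>, \<open>R (arev S a)\<close>. The first case is that of two present edges separated by the edge
  itself from the absent ones; in the second case the dual edge separates them. The third
  case contains the empty quadrangle, with the two matchings of weights \<open>\<alpha>\<^sup>2\<close> and \<open>\<beta>\<^sup>2\<close>. In every other case
  (an odd number of present edges, or two opposite ones) the uncovered corners cannot be matched.
\<close>
lemma quadrangle_weight_sum:
  fixes N :: "'a set"
  assumes a: "a \<in> darts"
  defines "L \<equiv> \<lambda>b. b \<in> N" and "R \<equiv> \<lambda>b. inv (rot S) b \<in> N"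
  shows "(\<Sum>K\<in>quadrangle_matchings N (arc_edge S a). dimer_weight S J K) =
    (if L a = R (arev S a) \<and> R a = L (arev S a) \<and> L a \<noteq> R a then edge_weight S J (Parallel a)
     else if L a = R a \<and> L (arev S a) = R (arev S a) \<and> L a \<noteq> L (arev S a)
       then edge_weight S J (Dual_parallel a)
     else if L a = R a \<and> L (arev S a) = R (arev S a) then 1 else 0)"
proof -
  let ?b = "arev S a"
  let ?T = "{Parallel a, Parallel ?b, Dual_parallel a, Dual_parallel ?b}"
  define \<alpha> where "\<alpha> = edge_weight S J (Parallel a)"
  define \<beta> where "\<beta> = edge_weight S J (Dual_parallel a)"
  have ab: "a \<noteq> ?b" "?b \<in> darts" using arev_neq[OF a] a by auto
  have w: "edge_weight S J (Parallel ?b) = \<alpha>" "edge_weight S J (Dual_parallel ?b) = \<beta>"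
    by (simp_all add: \<alpha>_def \<beta>_def arc_edge_def insert_commute)
  have one: "\<alpha> * \<alpha> + \<beta> * \<beta> = 1"
  proof -
    define y where "y = exp (- 2 * J (arc_edge S a))"
    have y: "exp (- 4 * J (arc_edge S a)) = y * y" by (simp add: y_def mult_exp_exp)
    have "1 + y * y > 0" by (simp add: y_def add_pos_pos)
    then show ?thesis
      unfolding \<alpha>_def \<beta>_def edge_weight.simps y y_def[symmetric]
      by (simp add: divide_simps) algebra
  qed
  define one3 where "one3 = (\<lambda>p q r. (p \<and> \<not> q \<and> \<not> r) \<or> (\<not> p \<and> q \<and> \<not> r) \<or> (\<not> p \<and> \<not> q \<and> r))"
  define valid where "valid K \<longleftrightarrow>
    one3 (L a) (Parallel a \<in> K) (Dual_parallel a \<in> K) \<and>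
    one3 (R a) (Parallel ?b \<in> K) (Dual_parallel a \<in> K) \<and>
    one3 (L ?b) (Parallel ?b \<in> K) (Dual_parallel ?b \<in> K) \<and>
    one3 (R ?b) (Parallel a \<in> K) (Dual_parallel ?b \<in> K)" for K
  have T: "quadrangle (arc_edge S a) = ?T" by (auto simp: quadrangle_def arc_edge_def)
  have "quadrangle_matchings N (arc_edge S a) = {K \<in> Pow ?T. valid K}"
  proof -
    have C: "corners (arc_edge S a) = {(a, Lft), (a, Rgt), (?b, Lft), (?b, Rgt)}"
      unfolding corners_def arc_edge_def using side.exhaust by auto
    have covers: "(\<forall>x\<in>corners (arc_edge S a). \<exists>!q. q \<in> External ` N \<union> K \<and> x \<in> quadri_ends S q) \<longleftrightarrow> valid K"
      if "K \<subseteq> ?T" for K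
    proof -
      have ext: "External c \<in> External ` N \<union> K \<longleftrightarrow> c \<in> N" for c using that by auto
      have int: "Parallel c \<in> External ` N \<union> K \<longleftrightarrow> Parallel c \<in> K"
        "Dual_parallel c \<in> External ` N \<union> K \<longleftrightarrow> Dual_parallel c \<in> K" for c by auto
      have *: "(\<exists>!q. q \<in> External ` N \<union> K \<and> (q = External c \<or> q = Parallel d \<or> q = Dual_parallel d'))
          \<longleftrightarrow> one3 (c \<in> N) (Parallel d \<in> K) (Dual_parallel d' \<in> K)" for c d d'
        by (subst ex1_three_iff) (simp_all only: ext int one3_def, simp)
      show ?thesis
        unfolding C valid_def L_def R_def ball_simps covers_Lft_iff[OF a] covers_Rgt_iff[OF a]
          covers_Lft_iff[OF ab(2)] covers_Rgt_iff[OF ab(2)] arev_arev *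
        by simp
    qed
    show ?thesis
      unfolding quadrangle_matchings_def T Pow_iff
      by (rule Collect_cong) (rule conj_cong[OF refl covers])
  qed
  then have "(\<Sum>K\<in>quadrangle_matchings N (arc_edge S a). dimer_weight S J K) =
      (\<Sum>K\<in>Pow ?T. if valid K then dimer_weight S J K else 0)"
    by (simp only: sum.inter_filter finite_Pow_iff finite.intros)
  also have "\<dots> = (if L a = R ?b \<and> R a = L ?b \<and> L a \<noteq> R a then \<alpha>
     else if L a = R a \<and> L ?b = R ?b \<and> L a \<noteq> L ?b then \<beta>
     else if L a = R a \<and> L ?b = R ?b then 1 else 0)"
    using ab(1) one
    by (cases "L a"; cases "R a"; cases "L ?b"; cases "R ?b")
       (simp_all add: sum_Pow_insert valid_def one3_def dimer_weight_def w
          \<alpha>_def[symmetric] \<beta>_def[symmetric] del: edge_weight.simps)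
  finally show ?thesis unfolding \<alpha>_def \<beta>_def .
qed

lemma quadri_edges_eq: "quadri_edges S = External ` darts \<union> (\<Union>e\<in>edges S. quadrangle e)"
proof -
  have "(\<Union>e\<in>edges S. quadrangle e) = Parallel ` \<Union>(edges S) \<union> Dual_parallel ` \<Union>(edges S)"
    unfolding quadrangle_def by blast
  then show ?thesis
    unfolding quadri_edges_def medial_graph_def Union_edges by (simp add: Un_assoc)
qed

lemma finite_quadrangle: "e \<in> edges S \<Longrightarrow> finite (quadrangle e)"
  by (simp add: quadrangle_def finite_edge)

lemma quadrangles_disjoint:
  assumes "e \<in> edges S" "e' \<in> edges S" "e \<noteq> e'"
  shows "quadrangle e \<inter> quadrangle e' = {}"
  using edges_disjoint[OF assms] by (auto simp: quadrangle_def)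

lemma cover_in_quadrangle:
  assumes e: "e \<in> edges S" and x: "x \<in> corners e" and cover: "x \<in> quadri_ends S q"
    and int: "q \<in> (\<Union>e\<in>edges S. quadrangle e)"
  shows "q \<in> quadrangle e"
proof -
  obtain a where a: "a \<in> darts" "arev S a \<in> darts" "e = {a, arev S a}"
    using e by (rule edgeE)
  obtain b s where b: "x = (b, s)" "b \<in> e" using x by (auto simp: corners_def)
  then have "b \<in> darts" "arev S b \<in> e" using a by auto
  then show ?thesis
    using cover int b covers_Lft_iff[of b q] covers_Rgt_iff[of b q]
    by (cases s) (auto simp: quadrangle_def)
qed

lemma External_notin_quadrangles: "External c \<notin> (\<Union>e\<in>edges S. quadrangle e)"
  by (auto simp: quadrangle_def)

text \<open>Every internal edge that covers a corner belongs to the quadrangle of this corner.\<close>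
lemma dimer_config_iff_local:
  assumes N: "N \<subseteq> darts" and I: "I \<subseteq> (\<Union>e\<in>edges S. quadrangle e)"
  shows "External ` N \<union> I \<in> dimer_configs S \<longleftrightarrow>
    (\<forall>e\<in>edges S. I \<inter> quadrangle e \<in> quadrangle_matchings N e)"
proof -
  have "External ` N \<union> I \<subseteq> quadri_edges S"
    using N I unfolding quadri_edges_eq by blast
  then have "External ` N \<union> I \<in> dimer_configs S \<longleftrightarrow>
      (\<forall>e\<in>edges S. \<forall>x\<in>corners e. \<exists>!q. q \<in> External ` N \<union> I \<and> x \<in> quadri_ends S q)"
    unfolding dimer_configs_def quadri_verts_def medial_graph_def by simp
  also have "\<dots> \<longleftrightarrow> (\<forall>e\<in>edges S. I \<inter> quadrangle e \<in> quadrangle_matchings N e)"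
  proof (rule ball_cong[OF refl])
    fix e assume e: "e \<in> edges S"
    have "q \<in> External ` N \<union> I \<and> x \<in> quadri_ends S q \<longleftrightarrow>
        q \<in> External ` N \<union> (I \<inter> quadrangle e) \<and> x \<in> quadri_ends S q" if "x \<in> corners e" for x q
      using cover_in_quadrangle[OF e that] I by blast
    then show "(\<forall>x\<in>corners e. \<exists>!q. q \<in> External ` N \<union> I \<and> x \<in> quadri_ends S q) \<longleftrightarrow>
        I \<inter> quadrangle e \<in> quadrangle_matchings N e"
      unfolding quadrangle_matchings_def by simp
  qed
  finally show ?thesis .
qed

lemma finite_quadri_edges: "finite (quadri_edges S)"
  unfolding quadri_edges_eq
  by (intro finite_UnI finite_imageI finite_UN_I finite_darts finite_edges finite_quadrangle)

lemma finite_dimer_configs: "finite (dimer_configs S)"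
  by (rule finite_subset[of _ "Pow (quadri_edges S)"])
     (auto simp: dimer_configs_def finite_quadri_edges)

definition external_part :: "'a quadri_edge set \<Rightarrow> 'a set" where
  "external_part M = {a. External a \<in> M}"

lemma external_part_subset: "M \<in> dimer_configs S \<Longrightarrow> external_part M \<subseteq> darts"
  by (auto simp: dimer_configs_def quadri_edges_def medial_graph_def external_part_def)

lemma sum_dimers_with_external_part:
  assumes N: "N \<subseteq> darts"
  shows "(\<Sum>M | M \<in> dimer_configs S \<and> external_part M = N. dimer_weight S J M) =
    (\<Prod>e\<in>edges S. \<Sum>K\<in>quadrangle_matchings N e. dimer_weight S J K)"
proof -
  let ?Q = "\<Union>e\<in>edges S. quadrangle e"
  let ?I = "{I. I \<subseteq> ?Q \<and> (\<forall>e\<in>edges S. I \<inter> quadrangle e \<in> quadrangle_matchings N e)}"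
  have "(\<Sum>M | M \<in> dimer_configs S \<and> external_part M = N. dimer_weight S J M) =
      (\<Sum>I\<in>?I. dimer_weight S J I)"
  proof (rule sum.reindex_bij_witness[where i = "\<lambda>I. External ` N \<union> I" and j = "\<lambda>M. M \<inter> ?Q"])
    fix M assume M: "M \<in> {M. M \<in> dimer_configs S \<and> external_part M = N}"
    then have sub: "M \<subseteq> External ` darts \<union> ?Q"
      by (simp add: dimer_configs_def quadri_edges_eq)
    have ext: "External c \<in> M \<longleftrightarrow> c \<in> N" for c
      using M by (auto simp: external_part_def)
    show eq: "External ` N \<union> M \<inter> ?Q = M"
      using sub ext by blast
    have "M \<inter> ?Q \<subseteq> ?Q" by blast
    from dimer_config_iff_local[OF N this] M show "M \<inter> ?Q \<in> ?I"
      unfolding eq by blast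
    have "finite M"
      using M finite_quadri_edges by (auto simp: dimer_configs_def dest: finite_subset)
    moreover have "edge_weight S J q = 1" if "q \<in> M - M \<inter> ?Q" for q
      using that sub by auto
    ultimately show "dimer_weight S J (M \<inter> ?Q) = dimer_weight S J M"
      unfolding dimer_weight_def by (intro prod.mono_neutral_left) auto
  next
    fix I assume I: "I \<in> ?I"
    then have sub: "I \<subseteq> ?Q" by blast
    then show "(External ` N \<union> I) \<inter> ?Q = I"
      using External_notin_quadrangles by blast
    have "external_part (External ` N \<union> I) = N"
      using sub External_notin_quadrangles by (auto simp: external_part_def)
    then show "External ` N \<union> I \<in> {M. M \<in> dimer_configs S \<and> external_part M = N}"
      using dimer_config_iff_local[OF N sub] I by blast
  qed
  also have "\<dots> = (\<Prod>e\<in>edges S. \<Sum>K\<in>quadrangle_matchings N e. dimer_weight S J K)"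
    unfolding dimer_weight_def using finite_edges finite_quadrangle quadrangles_disjoint
    by (intro sum_local_choices) (auto simp: quadrangle_matchings_def)
  finally show ?thesis .
qed

section \<open>Contour expansion of the dimer model\<close>
lemma Poly1_iff:
  fixes M :: "'a quadri_edge set"
  assumes a: "a \<in> darts"
  defines "L \<equiv> \<lambda>b. External b \<in> M" and "R \<equiv> \<lambda>b. External (inv (rot S) b) \<in> M"
  shows "arc_edge S a \<in> Poly1 S M \<longleftrightarrow> L a = R (arev S a) \<and> R a = L (arev S a) \<and> L a \<noteq> R a"
proof -
  let ?X = "{x \<in> corners (arc_edge S a). External (medial_edge_at S x) \<in> M}"
  have X: "(b, Lft) \<in> ?X \<longleftrightarrow> b \<in> arc_edge S a \<and> L b" "(b, Rgt) \<in> ?X \<longleftrightarrow> b \<in> arc_edge S a \<and> R b" for b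
    by (auto simp: corners_def medial_edge_at_def L_def R_def)
  have sides: "(\<forall>s. Q s) \<longleftrightarrow> Q Lft \<and> Q Rgt" for Q
    using side.exhaust by metis
  have eqI: "X = Y \<longleftrightarrow> (\<forall>b. ((b, Lft) \<in> X \<longleftrightarrow> (b, Lft) \<in> Y) \<and> ((b, Rgt) \<in> X \<longleftrightarrow> (b, Rgt) \<in> Y))"
    for X Y :: "('a \<times> side) set"
    by (simp only: set_eq_iff split_paired_All sides)
  have X_eq: "?X = {(c, Lft), (d, Rgt)} \<longleftrightarrow> L c \<and> R d \<and> \<not> R c \<and> \<not> L d"
    if "arc_edge S a = {c, d}" "c \<noteq> d" for c d
  proof -
    have "?X = {(c, Lft), (d, Rgt)} \<longleftrightarrow>
      (\<forall>b. (b \<in> {c, d} \<and> L b \<longleftrightarrow> b = c) \<and> (b \<in> {c, d} \<and> R b \<longleftrightarrow> b = d))"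
      unfolding eqI X unfolding that(1) by simp
    also have "\<dots> \<longleftrightarrow> L c \<and> R d \<and> \<not> R c \<and> \<not> L d" (is "(\<forall>b. ?Q b) \<longleftrightarrow> ?C")
    proof
      assume "\<forall>b. ?Q b"
      then have "?Q c" "?Q d" by blast+
      then show ?C using that(2) by simp
    next
      assume ?C
      then show "\<forall>b. ?Q b" by auto
    qed
    finally show ?thesis .
  qed
  have edge: "arc_edge S a = {a, arev S a}" "arc_edge S a = {arev S a, a}"
    by (auto simp: arc_edge_def)
  have "arc_edge S a \<in> Poly1 S M \<longleftrightarrow> (\<exists>c\<in>{a, arev S a}. ?X = {(c, Lft), (arev S c, Rgt)})"
    unfolding Poly1_def edge(1)[symmetric] using arc_edge_in_edges[OF a] by simp
  also have "\<dots> \<longleftrightarrow> ?X = {(a, Lft), (arev S a, Rgt)} \<or> ?X = {(arev S a, Lft), (a, Rgt)}"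
    by simp
  also have "\<dots> \<longleftrightarrow> (L a \<and> R (arev S a) \<and> \<not> R a \<and> \<not> L (arev S a)) \<or>
      (L (arev S a) \<and> R a \<and> \<not> R (arev S a) \<and> \<not> L a)"
    unfolding X_eq[OF edge(1) arev_neq[OF a, symmetric]] X_eq[OF edge(2) arev_neq[OF a]] ..
  finally show ?thesis by argo
qed

lemma Poly1_subset: "Poly1 S M \<subseteq> edges S"
  by (auto simp: Poly1_def)

text \<open>Hence \<open>Poly1\<close> is constant on the dimer configurations with given external edges.\<close>
lemma Poly1_external_part: "Poly1 S (External ` external_part M) = Poly1 S M"
proof -
  have "External c \<in> External ` external_part M \<longleftrightarrow> External c \<in> M" for c
    by (auto simp: external_part_def)
  then show ?thesis unfolding Poly1_def by simp
qed

text \<open>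
  The vertex of the corner \<open>a\<close> is the tail of \<open>a\<close>, and its face is the one on the left of \<open>a\<close>.
\<close>
definition corner_config :: "'a set set \<Rightarrow> 'v set \<Rightarrow> 'a set" where
  "corner_config F A = {a \<in> darts. (origin a \<in> A) \<noteq> (left_face S a \<in> F)}"

lemma corner_config_iff:
  assumes "a \<in> darts"
  shows "a \<in> corner_config F A \<longleftrightarrow> (origin a \<in> A) \<noteq> (left_face S a \<in> F)"
    "inv (rot S) a \<in> corner_config F A \<longleftrightarrow> (origin a \<in> A) \<noteq> (left_face S (arev S a) \<in> F)"
  using assms by (simp_all add: corner_config_def origin_inv_rot left_face_inv_rot)

lemma corner_config_subset: "corner_config F A \<subseteq> darts"
  by (auto simp: corner_config_def)

text \<open>
  Around an edge the four corners combine two vertices and two faces. The local pattern therefore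
  records whether the two faces differ, that is whether the edge belongs to the
  boundary of \<open>F\<close>, and whether the two vertices differ, that is whether it is cut. If both differ, the
  pattern is alternating and has weight 0.
\<close>
lemma corner_config_weight:
  assumes "e \<in> edges S"
  shows "(\<Sum>K\<in>quadrangle_matchings (corner_config F A) e. dimer_weight S J K) =
    contour_factor J (face_boundary S F) A e"
proof -
  obtain a where a: "a \<in> darts" "arev S a \<in> darts" "arc_edge S a = e"
    using assms by (rule edgeE)
  show ?thesis
    unfolding a(3)[symmetric] quadrangle_weight_sum[OF a(1)] contour_factor_def
      corner_config_iff[OF a(1)] corner_config_iff[OF a(2)] arev_arev
      face_boundary_iff[OF a(1)] vertex_cut_iff[OF a(1)] edge_weight.simps
    by (cases "origin a \<in> A"; cases "origin (arev S a) \<in> A";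
        cases "left_face S a \<in> F"; cases "left_face S (arev S a) \<in> F") simp_all
qed

lemma Poly1_corner_config:
  "Poly1 S (External ` corner_config F A) = face_boundary S F - vertex_cut A"
proof (rule edges_eqI)
  fix a assume a: "a \<in> darts"
  then have a': "arev S a \<in> darts" by simp
  have ext: "External c \<in> External ` N \<longleftrightarrow> c \<in> N" for c and N :: "'a set" by auto
  show "arc_edge S a \<in> Poly1 S (External ` corner_config F A) \<longleftrightarrow>
      arc_edge S a \<in> face_boundary S F - vertex_cut A"
    unfolding Poly1_iff[OF a] ext corner_config_iff[OF a] corner_config_iff[OF a'] arev_arev
      Diff_iff face_boundary_iff[OF a] vertex_cut_iff[OF a] by blast
next
  show "Poly1 S (External ` corner_config F A) \<subseteq> edges S" by (rule Poly1_subset)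
  show "face_boundary S F - vertex_cut A \<subseteq> edges S" using face_boundary_subset by blast
qed

lemma corner_config_inj: "inj_on (corner_config F) (Pow origins)"
proof (rule inj_onI)
  fix A B assume AB: "A \<in> Pow origins" "B \<in> Pow origins" "corner_config F A = corner_config F B"
  have "origin a \<in> A \<longleftrightarrow> origin a \<in> B" if "a \<in> darts" for a
    using AB(3) corner_config_iff(1)[OF that, of F A] corner_config_iff(1)[OF that, of F B] by blast
  then show "A = B" using AB(1,2) by blast
qed

text \<open>
  Nonzero local weights force the presence of medial edges to change, when an arc is crossed around its
  tail, exactly if its edge belongs to \<open>Poly1\<close>. The indicator of \<open>F\<close> at the adjacent faces changes at the
  same arcs. The sum modulo 2 of these two functions of the corner is thus constant around each vertex,
  and defines \<open>A\<close>.
\<close>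
lemma corner_config_surj:
  assumes N: "N \<subseteq> darts" and poly: "Poly1 S (External ` N) = face_boundary S F"
    and weight: "\<And>e. e \<in> edges S \<Longrightarrow> (\<Sum>K\<in>quadrangle_matchings N e. dimer_weight S J K) \<noteq> 0"
  shows "\<exists>A\<in>Pow origins. N = corner_config F A"
proof -
  define c where "c a \<longleftrightarrow> (a \<in> N) \<noteq> (left_face S a \<in> F)" for a
  have ext: "External c \<in> External ` N \<longleftrightarrow> c \<in> N" for c by auto
  have "c (rot S a) = c a" if "a \<in> darts" for a
  proof -
    have b: "rot S a \<in> darts" using that by simp
    have "(rot S a \<in> N) \<noteq> (a \<in> N) \<longleftrightarrow> arc_edge S (rot S a) \<in> Poly1 S (External ` N)"
      using weight[OF arc_edge_in_edges[OF b]]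
      unfolding quadrangle_weight_sum[OF b] Poly1_iff[OF b] ext rot_inv
      by (auto split: if_splits)
    also have "\<dots> \<longleftrightarrow> (left_face S (rot S a) \<in> F) \<noteq> (left_face S a \<in> F)"
      unfolding poly face_boundary_iff[OF b] left_face_inv_rot[of "rot S a", symmetric] rot_inv by blast
    finally show ?thesis unfolding c_def by blast
  qed
  then have const: "c a = c b" if "a \<in> darts" "b \<in> darts" "origin a = origin b" for a b
    using rot_invariant_imp_origin_invariant[of c] that by blast
  let ?A = "origin ` {a \<in> darts. c a}"
  have "origin a \<in> ?A \<longleftrightarrow> c a" if "a \<in> darts" for a
    unfolding image_iff using const that by blast
  then have "N = corner_config F ?A"
    using N unfolding corner_config_def c_def by blast
  then show ?thesis by blast
qed

text \<open>
  By the previous lemma only the configurations \<open>corner_config F A\<close> contribute. The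
  condition \<open>Poly1 = P\<close> then says that the cut of \<open>A\<close> avoids \<open>P\<close>, and it may be dropped because the weights of
  the remaining sets \<open>A\<close> vanish.
\<close>
lemma dimer_contour_expansion:
  assumes P: "P = face_boundary S F"
  shows "(\<Sum>M | M \<in> dimer_configs S \<and> Poly1 S M = P. dimer_weight S J M) =
    (\<Sum>A\<in>Pow origins. \<Prod>e\<in>edges S. contour_factor J P A e)"
proof -
  let ?w = "\<lambda>N. \<Prod>e\<in>edges S. \<Sum>K\<in>quadrangle_matchings N e. dimer_weight S J K"
  let ?N = "{N \<in> Pow darts. Poly1 S (External ` N) = P}"
  let ?A = "{A \<in> Pow origins. P \<inter> vertex_cut A = {}}"
  define D where "D = {M \<in> dimer_configs S. Poly1 S M = P}"
  have "finite D" using finite_dimer_configs by (simp add: D_def)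
  moreover have "finite ?N" using finite_darts by simp
  moreover have "external_part ` D \<subseteq> ?N"
    by (rule image_subsetI) (simp add: D_def Poly1_external_part external_part_subset)
  ultimately have "(\<Sum>M\<in>D. dimer_weight S J M) =
      (\<Sum>N\<in>?N. \<Sum>M | M \<in> D \<and> external_part M = N. dimer_weight S J M)"
    by (rule sum.group[of D ?N external_part "dimer_weight S J", symmetric])
  also have "\<dots> = (\<Sum>N\<in>?N. \<Sum>M | M \<in> dimer_configs S \<and> external_part M = N. dimer_weight S J M)"
  proof (rule sum.cong[OF refl])
    fix N assume "N \<in> ?N"
    then have "Poly1 S M = P" if "external_part M = N" for M
      using that Poly1_external_part[of M] by simp
    then have "{M. M \<in> D \<and> external_part M = N} = {M. M \<in> dimer_configs S \<and> external_part M = N}"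
      unfolding D_def by blast
    then show "(\<Sum>M | M \<in> D \<and> external_part M = N. dimer_weight S J M) =
        (\<Sum>M | M \<in> dimer_configs S \<and> external_part M = N. dimer_weight S J M)" by simp
  qed
  also have "\<dots> = (\<Sum>N\<in>?N. ?w N)"
    by (intro sum.cong) (auto simp: sum_dimers_with_external_part)
  also have "\<dots> = (\<Sum>N\<in>corner_config F ` ?A. ?w N)"
  proof (rule sum.mono_neutral_right)
    show "finite ?N" using finite_darts by simp
    show "corner_config F ` ?A \<subseteq> ?N"
    proof (rule image_subsetI)
      fix A assume "A \<in> ?A"
      then show "corner_config F A \<in> ?N"
        by (simp add: Poly1_corner_config P Diff_triv corner_config_subset)
    qed
    show "\<forall>N\<in>?N - corner_config F ` ?A. ?w N = 0"
    proof
      fix N assume N: "N \<in> ?N - corner_config F ` ?A"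
      show "?w N = 0"
      proof (rule ccontr)
        assume "?w N \<noteq> 0"
        then have "\<forall>e\<in>edges S. (\<Sum>K\<in>quadrangle_matchings N e. dimer_weight S J K) \<noteq> 0"
          by (simp add: prod_zero_iff[OF finite_edges])
        then have "\<exists>A\<in>Pow origins. N = corner_config F A"
          using N P by (intro corner_config_surj[of N F J]) auto
        then obtain A where A: "A \<in> Pow origins" "N = corner_config F A" by blast
        then have "P - vertex_cut A = P"
          using N Poly1_corner_config[of F A] P by simp
        then have "A \<in> ?A" using A(1) by blast
        then show False using A(2) N by blast
      qed
    qed
  qed
  also have "\<dots> = (\<Sum>A\<in>?A. ?w (corner_config F A))"
    by (subst sum.reindex) (auto intro!: inj_on_subset[OF corner_config_inj])
  also have "\<dots> = (\<Sum>A\<in>?A. \<Prod>e\<in>edges S. contour_factor J P A e)"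
    unfolding P by (intro sum.cong prod.cong refl corner_config_weight)
  also have "\<dots> = (\<Sum>A\<in>Pow origins. \<Prod>e\<in>edges S. contour_factor J P A e)"
  proof (rule sum.mono_neutral_left)
    show "\<forall>A\<in>Pow origins - ?A. (\<Prod>e\<in>edges S. contour_factor J P A e) = 0"
    proof
      fix A assume "A \<in> Pow origins - ?A"
      then obtain e where "e \<in> P" "e \<in> vertex_cut A" by blast
      then have "e \<in> edges S" "contour_factor J P A e = 0"
        using P face_boundary_subset by (auto simp: contour_factor_def)
      then show "(\<Prod>e\<in>edges S. contour_factor J P A e) = 0"
        using finite_edges by (intro prod_zero) auto
    qed
  qed (use finite_darts in auto)
  finally show ?thesis unfolding D_def .
qed

section \<open>Equality of the two laws\<close>
lemma sum_dIsing_XOR: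
  assumes rep: "\<forall>\<epsilon> \<in> H1 S. rep \<epsilon> \<in> polygons_of_class S \<epsilon>"
    and P: "P \<in> polygons_of_class S (zero_homology S)"
  shows "(\<Sum>\<omega> | \<omega> \<in> dIsing_configs S \<and> XOR_config S rep \<omega> = P. dIsing_weight J \<omega>) =
    (\<Sum>Q\<in>polygons S. dIsing_weight J (Q, sym_diff Q P))"
proof (rule sum.reindex_bij_witness[where i = "\<lambda>Q. (Q, sym_diff Q P)" and j = fst])
  fix \<omega> assume \<omega>: "\<omega> \<in> {\<omega>. \<omega> \<in> dIsing_configs S \<and> XOR_config S rep \<omega> = P}"
  obtain Q Q' where \<omega>_eq: "\<omega> = (Q, Q')" by fastforce
  then have hom: "(Q, Q') \<in> homologous S" using \<omega> by (simp add: dIsing_configs_eq)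
  have "sym_diff Q Q' = P"
    using XOR_config_eq_sym_diff[OF rep hom] \<omega> \<omega>_eq by simp
  then have "Q' = sym_diff Q P" by blast
  then show "(fst \<omega>, sym_diff (fst \<omega>) P) = \<omega>" "fst \<omega> \<in> polygons S"
    "dIsing_weight J (fst \<omega>, sym_diff (fst \<omega>) P) = dIsing_weight J \<omega>"
    using \<omega>_eq homologous_imp_polygons[OF hom] by simp_all
next
  fix Q assume Q: "Q \<in> polygons S"
  have "P \<in> polygons S" using P by (simp add: polygons_of_class_def)
  have eq: "sym_diff Q (sym_diff Q P) = P" by blast
  have "(Q, sym_diff Q P) \<in> homologous S"
    unfolding homologous_iff_sym_diff eq using Q P polygons_sym_diff[OF Q \<open>P \<in> polygons S\<close>] by blast
  then show "(Q, sym_diff Q P) \<in> {\<omega>. \<omega> \<in> dIsing_configs S \<and> XOR_config S rep \<omega> = P}"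
    using XOR_config_eq_sym_diff[OF rep] eq by (simp add: dIsing_configs_eq)
qed simp

lemma XOR_same_law_as_Poly1:
  assumes J: "\<forall>e \<in> dual_edges S. J e > 0"
    and rep: "\<forall>\<epsilon> \<in> H1 S. rep \<epsilon> \<in> polygons_of_class S \<epsilon>"
    and P: "P \<in> polygons_of_class S (zero_homology S)"
  shows "\<P>(\<omega> in dIsing S J. XOR_config S rep \<omega> = P) = \<P>(M in quadri0 S J. Poly1 S M = P)"
proof -
  let ?K = "polygons_of_class S (zero_homology S)"
  let ?c = "(\<Prod>e\<in>edges S. 1 + exp (- 4 * J e)) / 2 ^ card origins"
  have K: "?K \<subseteq> polygons S" by (auto simp: polygons_of_class_def)
  have weight_nonneg: "0 \<le> edge_weight S J q" if "q \<in> quadri_edges S" for q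
  proof -
    have "dual_edges S = edges S" by (simp add: dual_edges_def dual_graph_def edges_def)
    then have "0 < J (arc_edge S a)" if "a \<in> darts" for a
      using J that arc_edge_in_edges by blast
    then show ?thesis
      using that by (auto simp: quadri_edges_def medial_graph_def add_pos_pos less_imp_le)
  qed
  show ?thesis
    unfolding dIsing_def quadri0_def
  proof (rule gibbs_measures_same_law[where K = ?K and c = ?c])
    show "finite (dIsing_configs S)"
      using finite_polygons finite_subset[of "homologous S" "polygons S \<times> polygons S"]
      by (auto simp: dIsing_configs_eq homologous_def)
    show "finite (quadri0_configs S)"
      using finite_dimer_configs by (simp add: quadri0_configs_def)
    show "finite ?K" using K finite_polygons by (rule finite_subset)
    show "0 \<le> dIsing_weight J \<omega>" for \<omega>
      by (cases \<omega>) (simp add: dIsing_weight_def prod_nonneg)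
    show "0 \<le> dimer_weight S J M" if "M \<in> quadri0_configs S" for M
      unfolding dimer_weight_def using that weight_nonneg
      by (intro prod_nonneg) (auto simp: quadri0_configs_def dimer_configs_def)
    show "XOR_config S rep ` dIsing_configs S \<subseteq> ?K"
    proof
      fix Y assume "Y \<in> XOR_config S rep ` dIsing_configs S"
      then obtain Q Q' where "(Q, Q') \<in> homologous S" "Y = XOR_config S rep (Q, Q')"
        by (auto simp: dIsing_configs_eq)
      then show "Y \<in> ?K"
        using XOR_config_eq_sym_diff[OF rep] homologous_iff_sym_diff by simp
    qed
    show "Poly1 S ` quadri0_configs S \<subseteq> ?K" by (auto simp: quadri0_configs_def)
    have "0 < (\<Prod>e\<in>edges S. 1 + exp (- 4 * J e))"
      by (intro prod_pos) (auto simp: add_pos_pos)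
    then show "?c \<noteq> 0" by simp
    show "P \<in> ?K" by fact
    fix P' assume P': "P' \<in> ?K"
    then obtain F where F: "P' = face_boundary S F" and sub: "P' \<subseteq> edges S"
      using face_boundary_subset by (auto simp: polygons_of_zero_class_iff)
    have "{M. M \<in> quadri0_configs S \<and> Poly1 S M = P'} = {M. M \<in> dimer_configs S \<and> Poly1 S M = P'}"
      using P' by (auto simp: quadri0_configs_def)
    then show "(\<Sum>\<omega> | \<omega> \<in> dIsing_configs S \<and> XOR_config S rep \<omega> = P'. dIsing_weight J \<omega>) =
        ?c * (\<Sum>M | M \<in> quadri0_configs S \<and> Poly1 S M = P'. dimer_weight S J M)"
      using high_temperature_expansion[OF sub, of J] sum_dIsing_XOR[OF rep P', of J]
        dimer_contour_expansion[OF F, of J] by (simp add: field_simps)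
  qed
qed

end

theorem theorem3:
  fixes S :: "('v, 'a) surface_graph"
    and J :: "'a set \<Rightarrow> real"
    and rep :: "'a set set set \<Rightarrow> 'a set set"
  assumes "cellularly_embedded S"
    and "\<forall>e \<in> dual_edges S. J e > 0"
    and "\<forall>\<epsilon> \<in> H1 S. rep \<epsilon> \<in> polygons_of_class S \<epsilon>"
  shows "\<forall>P \<in> polygons_of_class S (zero_homology S).
           \<P>(\<omega> in dIsing S J. XOR_config S rep \<omega> = P) = \<P>(M in quadri0 S J. Poly1 S M = P)"
  using embedded_graph.XOR_same_law_as_Poly1[OF embedded_graph.intro] assms by blast

end
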